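(* Let $\mathcal F$ be an inversive $\sigma$-field of characteristic zero. For a partial character $\rho$ on $\mathbb Z[x]^n$ put $$\mathcal I(\rho)=[\mathbb Y^{\mathbf f}-\rho(\mathbf f)\mid\mathbf f\in L_\rho]\subset\mathcal F\{\mathbb Y^\pm\},\qquad \mathcal I^+(\rho)=[\mathbb Y^{\mathbf f^+}-\rho(\mathbf f)\mathbb Y^{\mathbf f^-}\mid\mathbf f\in L_\rho]\subset\mathcal F\{\mathbb Y\}.$$ Then the map $\mathcal I(\rho)\mapsto\mathcal I^+(\rho)$ gives a one to one correspondence between proper Laurent binomial $\sigma$-ideals of $\mathcal F\{\mathbb Y^\pm\}$ and proper normal binomial $\sigma$-ideals of $\mathcal F\{\mathbb Y\}$.
   Context: A $\sigma$-field is a field $\mathcal F$ with a ring endomorphism $\sigma$ with $\sigma(a)=0$ iff $a=0$; inversive means $\sigma$ bijective. $\mathbb Y=\{y_1,\ldots,y_n\}$ are difference indeterminates; $\mathcal F\{\mathbb Y\}$ is the difference polynomial ring. For $p=\sum_i c_ix^i\in\mathbb Z[x]$, $a^p:=\prod_i\sigma^i(a)^{c_i}$; for $\mathbf f\in\mathbb Z[x]^n$, $\mathbb Y^{\mathbf f}:=\prod_iy_i^{f_i}$. $\mathcal F\{\mathbb Y^\pm\}$ is the ring of Laurent difference polynomials (finite $\mathcal F$-linear combinations of the $\mathbb Y^{\mathbf f}$). For $\mathbf f\in\mathbb Z[x]^n$, $\mathbf f=\mathbf f^+-\mathbf f^-$ with $\mathbf f^\pm\in\mathbb N[x]^n$ the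 positive and negative parts (collecting positive, resp. negative, coefficients). A $\sigma$-ideal is an ideal closed under $\sigma$; $[S]$ is the $\sigma$-ideal generated by $S$ in the ring in question. A Laurent binomial $\sigma$-ideal is one generated by elements $a\mathbb Y^{\mathbf g}+b\mathbb Y^{\mathbf h}$ of $\mathcal F\{\mathbb Y^\pm\}$ ($a,b\in\mathcal F$); a binomial $\sigma$-ideal of $\mathcal F\{\mathbb Y\}$ is one generated by (possibly infinitely many) elements $a\mathbb Y^{\mathbf a}+b\mathbb Y^{\mathbf b}$ with $a,b\in\mathcal F$, $\mathbf a,\mathbf b\in\mathbb N[x]^n$. A $\sigma$-ideal $\mathcal I\subset\mathcal F\{\mathbb Y\}$ is normal if for every monomial $M$ in the $y_i^{(j)}=\sigma^j(y_i)$ and $p\in\mathcal F\{\mathbb Y\}$, $Mp\in\mathcal I$ implies $p\in\mathcal I$. A partial character $\rho$ on $\mathbb Z[x]^n$ is a homomorphism from a $\mathbb Z[x]$-submodule $L_\rho\subset\mathbb Z[x]^n$ to the multiplicative group $\mathcal F\setminus\{0\}$ with $\rho(x\mathbf f)=\sigma(\rho(\mathbf f))$. *)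

theory Defs
  imports
    "HOL-Analysis.Analysis"
    "HOL-Computational_Algebra.Polynomial"
    "HOL-Library.Poly_Mapping"
begin

(* The indeterminates y_i are indexed by a finite type 'n, so n = CARD('n) >= 1.
   Both difference rings are rings of finite F-linear combinations of monomials Y^f, that is,
   monoid algebras over F: the exponents f range over N[x]^n for F{Y} and over Z[x]^n for
   F{Y^pm}, where the coefficient of x^j in f_i is the exponent of y_i^(j) = sigma^j(y_i).
   The multiplication is the convolution product of Poly_Mapping. *)

type_synonym ('f, 'c, 'n) exp_alg = "('c poly)^'n \<Rightarrow>\<^sub>0 'f"
type_synonym ('f, 'n) diff_poly = "('f, nat, 'n) exp_alg"
type_synonym ('f, 'n) laurent_diff_poly = "('f, int, 'n) exp_alg"

definition diff_field :: "('f::field \<Rightarrow> 'f) \<Rightarrow> bool" where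
  "diff_field \<sigma> \<longleftrightarrow>
     (\<forall>a b. \<sigma> (a + b) = \<sigma> a + \<sigma> b) \<and> (\<forall>a b. \<sigma> (a * b) = \<sigma> a * \<sigma> b) \<and> \<sigma> 1 = 1 \<and>
     (\<forall>a. \<sigma> a = 0 \<longleftrightarrow> a = 0)"

definition inversive_diff_field :: "('f::field \<Rightarrow> 'f) \<Rightarrow> bool" where
  "inversive_diff_field \<sigma> \<longleftrightarrow> diff_field \<sigma> \<and> bij \<sigma>"

definition monom_Y :: "(('c::comm_semiring_1) poly)^'n \<Rightarrow> ('f::comm_semiring_1, 'c, 'n) exp_alg" where
  "monom_Y f = Poly_Mapping.single f 1"

definition const_Y :: "'f \<Rightarrow> ('f::comm_semiring_1, 'c::comm_semiring_1, 'n::finite) exp_alg" where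
  "const_Y c = Poly_Mapping.single 0 c"

(* sigma on F{Y} and F{Y^pm}:  sum of c_f Y^f  |->  sum of sigma(c_f) Y^(x f);
   the scalar [:0, 1:] is the polynomial x. *)
definition sigma_ext ::
  "('f \<Rightarrow> 'f) \<Rightarrow> ('f::comm_semiring_1, 'c::comm_semiring_1, 'n::finite) exp_alg \<Rightarrow> ('f, 'c, 'n) exp_alg" where
  "sigma_ext \<sigma> p =
     (\<Sum>f\<in>Poly_Mapping.keys p. Poly_Mapping.single ([:0, 1:] *s f) (\<sigma> (Poly_Mapping.lookup p f)))"

definition sigma_ideal :: "('r \<Rightarrow> 'r) \<Rightarrow> ('r::comm_ring_1) set \<Rightarrow> bool" where
  "sigma_ideal \<tau> I \<longleftrightarrow>
     0 \<in> I \<and> (\<forall>p\<in>I. \<forall>q\<in>I. p + q \<in> I) \<and> (\<forall>r. \<forall>p\<in>I. r * p \<in> I) \<and> (\<forall>p\<in>I. \<tau> p \<in> I)"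

definition gen_sigma_ideal :: "('r \<Rightarrow> 'r) \<Rightarrow> ('r::comm_ring_1) set \<Rightarrow> 'r set" where
  "gen_sigma_ideal \<tau> S = sigma_ideal \<tau> hull S"

(* Used at 'c = int for Laurent binomial sigma-ideals of F{Y^pm}
   and at 'c = nat for binomial sigma-ideals of F{Y}. *)
definition binomial_sigma_ideal ::
  "('f \<Rightarrow> 'f) \<Rightarrow> ('f::field, 'c::comm_semiring_1, 'n::finite) exp_alg set \<Rightarrow> bool" where
  "binomial_sigma_ideal \<sigma> I \<longleftrightarrow>
     (\<exists>S. S \<subseteq> {const_Y a * monom_Y g + const_Y b * monom_Y h | a b g h. True} \<and>
          I = gen_sigma_ideal (sigma_ext \<sigma>) S)"

definition normal_sigma_ideal ::
  "('f \<Rightarrow> 'f) \<Rightarrow> ('f::field, 'n::finite) diff_poly set \<Rightarrow> bool" where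
  "normal_sigma_ideal \<sigma> I \<longleftrightarrow>
     sigma_ideal (sigma_ext \<sigma>) I \<and> (\<forall>a p. monom_Y a * p \<in> I \<longrightarrow> p \<in> I)"

definition pos_part :: "(int poly)^'n::finite \<Rightarrow> (nat poly)^'n" where
  "pos_part f = (\<chi> i. map_poly nat (f $ i))"

definition neg_part :: "(int poly)^'n::finite \<Rightarrow> (nat poly)^'n" where
  "neg_part f = (\<chi> i. map_poly nat (- (f $ i)))"

(* The partial character is the restriction of rho to L; the values outside L are irrelevant. *)
definition partial_character ::
  "('f \<Rightarrow> 'f) \<Rightarrow> ((int poly)^'n::finite) set \<Rightarrow> ((int poly)^'n \<Rightarrow> 'f::field) \<Rightarrow> bool" where
  "partial_character \<sigma> L \<rho> \<longleftrightarrow>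
     module.subspace (*s) L \<and>
     (\<forall>f\<in>L. \<rho> f \<noteq> 0) \<and>
     (\<forall>f\<in>L. \<forall>g\<in>L. \<rho> (f + g) = \<rho> f * \<rho> g) \<and>
     (\<forall>f\<in>L. \<rho> ([:0, 1:] *s f) = \<sigma> (\<rho> f))"

definition laurent_char_ideal ::
  "('f \<Rightarrow> 'f) \<Rightarrow> ((int poly)^'n::finite) set \<Rightarrow> ((int poly)^'n \<Rightarrow> 'f::field) \<Rightarrow> ('f, 'n) laurent_diff_poly set" where
  "laurent_char_ideal \<sigma> L \<rho> =
     gen_sigma_ideal (sigma_ext \<sigma>) ((\<lambda>f. monom_Y f - const_Y (\<rho> f)) ` L)"

definition char_ideal ::
  "('f \<Rightarrow> 'f) \<Rightarrow> ((int poly)^'n::finite) set \<Rightarrow> ((int poly)^'n \<Rightarrow> 'f::field) \<Rightarrow> ('f, 'n) diff_poly set" where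
  "char_ideal \<sigma> L \<rho> =
     gen_sigma_ideal (sigma_ext \<sigma>)
       ((\<lambda>f. monom_Y (pos_part f) - const_Y (\<rho> f) * monom_Y (neg_part f)) ` L)"

(* Needed to unfold module.subspace in partial_character. *)
lemma module_vec: "module ((*s) :: 'a::comm_ring_1 \<Rightarrow> 'a^'n::finite \<Rightarrow> 'a^'n)"
  by unfold_locales
    (simp_all add: vector_add_ldistrib vector_sadd_rdistrib vector_smult_assoc)

lemma monom_Y_0: "monom_Y 0 = 1"
  by (simp add: monom_Y_def)

lemma monom_Y_add: "monom_Y (f + g) = monom_Y f * monom_Y g"
  by (simp add: monom_Y_def mult_single)

lemma prod_monom_Y: "finite A \<Longrightarrow> (\<Prod>a\<in>A. monom_Y (h a)) = monom_Y (\<Sum>a\<in>A. h a)"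
  by (induction A rule: finite_induct) (simp_all add: monom_Y_0 monom_Y_add)

lemma sigma_ext_single:
  assumes "\<sigma> 0 = 0"
  shows "sigma_ext \<sigma> (Poly_Mapping.single f c) = Poly_Mapping.single ([:0, 1:] *s f) (\<sigma> c)"
  using assms by (simp add: sigma_ext_def)

lemma sigma_ext_zero: "sigma_ext \<sigma> 0 = 0"
  by (simp add: sigma_ext_def)

lemma sigma_ext_superset:
  assumes "\<sigma> 0 = 0" "finite A" "Poly_Mapping.keys p \<subseteq> A"
  shows "sigma_ext \<sigma> p =
    (\<Sum>f\<in>A. Poly_Mapping.single ([:0, 1:] *s f) (\<sigma> (Poly_Mapping.lookup p f)))"
  unfolding sigma_ext_def
  using assms by (intro sum.mono_neutral_left) (auto simp: in_keys_iff)

lemma sigma_ext_add: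
  assumes "diff_field \<sigma>"
  shows "sigma_ext \<sigma> (p + q) = sigma_ext \<sigma> p + sigma_ext \<sigma> q"
proof -
  have 0: "\<sigma> 0 = 0" and add: "\<sigma> (a + b) = \<sigma> a + \<sigma> b" for a b
    using assms by (auto simp: diff_field_def)
  let ?A = "Poly_Mapping.keys p \<union> Poly_Mapping.keys q"
  have "sigma_ext \<sigma> r = (\<Sum>f\<in>?A. Poly_Mapping.single ([:0, 1:] *s f) (\<sigma> (Poly_Mapping.lookup r f)))"
    if "Poly_Mapping.keys r \<subseteq> ?A" for r
    by (rule sigma_ext_superset) (use 0 that in auto)
  then show ?thesis
    by (simp add: keys_add add lookup_add single_add sum.distrib)
qed

lemma sum_single_lookup:
  "p = (\<Sum>f\<in>Poly_Mapping.keys p. Poly_Mapping.single f (Poly_Mapping.lookup p f))"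
  by (rule poly_mapping_eqI)
    (simp add: lookup_sum lookup_single when_def in_keys_iff)

lemma poly_mapping_add_induct [case_names zero single_add]:
  fixes p :: "'a \<Rightarrow>\<^sub>0 'b::comm_monoid_add"
  assumes "P 0" "\<And>f c p. P p \<Longrightarrow> P (Poly_Mapping.single f c + p)"
  shows "P p"
proof -
  have "P (\<Sum>f\<in>A. Poly_Mapping.single f (Poly_Mapping.lookup p f))" if "finite A" for A
    using that by (induction A rule: finite_induct) (auto simp: assms)
  then show ?thesis
    by (subst sum_single_lookup) simp
qed

lemma sigma_ext_mult:
  assumes "diff_field \<sigma>"
  shows "sigma_ext \<sigma> (p * q) = sigma_ext \<sigma> p * sigma_ext \<sigma> q"
proof -
  have 0: "\<sigma> 0 = 0" and mult: "\<sigma> (a * b) = \<sigma> a * \<sigma> b" for a b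
    using assms by (auto simp: diff_field_def)
  have single: "sigma_ext \<sigma> (Poly_Mapping.single f a * Poly_Mapping.single g b) =
      sigma_ext \<sigma> (Poly_Mapping.single f a) * sigma_ext \<sigma> (Poly_Mapping.single g b)" for f g a b
    by (simp add: mult_single sigma_ext_single 0 mult vector_add_ldistrib)
  have "sigma_ext \<sigma> (Poly_Mapping.single f a * q) =
      sigma_ext \<sigma> (Poly_Mapping.single f a) * sigma_ext \<sigma> q" for f a
    by (induction q rule: poly_mapping_add_induct)
      (simp_all add: sigma_ext_zero single sigma_ext_add[OF assms] distrib_left)
  then show ?thesis
    by (induction p rule: poly_mapping_add_induct)
      (simp_all add: sigma_ext_zero sigma_ext_add[OF assms] distrib_right)
qed

(* monom_Y agrees with the product of the y_i^(f_i), where a^p is the product of the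
   sigma^j(a)^(p_j) and y_i = Y^(e_i). *)
lemma monom_Y_eq_prod:
  fixes f :: "(nat poly)^'n::finite" and \<sigma> :: "'f::field \<Rightarrow> 'f"
  assumes "diff_field \<sigma>"
  shows "(monom_Y f :: ('f, 'n) diff_poly) =
    (\<Prod>i\<in>UNIV. \<Prod>j\<le>degree (f $ i). ((sigma_ext \<sigma> ^^ j) (monom_Y (axis i 1))) ^ coeff (f $ i) j)"
proof -
  have 0: "\<sigma> 0 = 0" and 1: "\<sigma> 1 = 1"
    using assms by (auto simp: diff_field_def)
  have iter: "(sigma_ext \<sigma> ^^ j) (monom_Y (axis i 1)) = (monom_Y (axis i (monom 1 j)) :: ('f, 'n) diff_poly)"
    for i j
  proof (induction j)
    case (Suc j)
    have "[:0, 1:] *s axis i (monom 1 j) = (axis i (monom 1 (Suc j)) :: (nat poly)^'n)"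
      by (auto simp: vec_eq_iff axis_def poly_eq_iff coeff_pCons split: nat.splits)
    with Suc show ?case
      by (simp add: monom_Y_def sigma_ext_single 0 1)
  qed (simp add: monom_0 one_pCons)
  have pow: "monom_Y g ^ k = (monom_Y (of_nat k *s g) :: ('f, 'n) diff_poly)" for g k
    by (induction k) (simp_all add: monom_Y_0 vector_sadd_rdistrib monom_Y_add)
  have "(\<Sum>i\<in>UNIV. \<Sum>j\<le>degree (f $ i). of_nat (coeff (f $ i) j) *s axis i (monom 1 j)) = f"
  proof (subst vec_eq_iff, intro allI)
    fix k
    have "(\<Sum>i\<in>UNIV. \<Sum>j\<le>degree (f $ i). of_nat (coeff (f $ i) j) *s axis i (monom 1 j)) $ k
        = (\<Sum>i\<in>UNIV. if i = k then (\<Sum>j\<le>degree (f $ i). of_nat (coeff (f $ i) j) * monom 1 j) else 0)"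
      unfolding sum_component
      by (intro sum.cong) (auto simp: axis_def intro!: sum.neutral)
    also have "\<dots> = (\<Sum>j\<le>degree (f $ k). monom (coeff (f $ k) j) j)"
      by (simp add: of_nat_poly smult_monom)
    also have "\<dots> = f $ k"
      by (rule poly_as_sum_of_monoms)
    finally show "(\<Sum>i\<in>UNIV. \<Sum>j\<le>degree (f $ i). of_nat (coeff (f $ i) j) *s axis i (monom 1 j)) $ k = f $ k" .
  qed
  then show ?thesis
    by (simp add: iter pow prod_monom_Y)
qed

end

theory Submission
  imports Defs
begin

text \<open>
  The ring of Laurent difference polynomials is the localisation of the ring
  of difference polynomials at the monomials, and the correspondence is the usual one between
  ideals of a localisation and ideals that are saturated with respect to the inverted elements:
  contraction along the inclusion \<open>to_laurent\<close> in one direction and \<open>localised_ideal\<close> in the other.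
  A normal \<open>\<sigma>\<close>-ideal is exactly a saturated one, and both operations respect \<open>\<sigma>\<close>.
  It remains to see how binomials behave.

  A proper Laurent binomial \<open>\<sigma>\<close>-ideal \<open>I\<close> is determined by the \<open>f\<close> for which \<open>Y^f\<close> is congruent to a
  nonzero constant modulo \<open>I\<close>, together with these constants; they are unique and define a partial character
  (\<open>proper_binomial_laurent_ideal_is_char_ideal\<close>), because monomials are units and so each
  generating binomial can be divided by one of its two terms.

  The central point is that the contraction of \<open>\<I>(\<rho>)\<close> is generated by the binomials
  \<open>Y^(f\<^sup>+) - \<rho>(f) Y^(f\<^sup>-)\<close> (\<open>contraction_laurent_char_ideal\<close>).  Sort the terms of
  a polynomial by the coset of \<open>L\<close> that contains the exponent.  On each coset, weighting the coefficients by
  the character gives a linear functional (\<open>coset_weight\<close>) that vanishes on \<open>\<I>(\<rho>)\<close>.  Modulo the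
  binomials, two terms with exponents in the same coset can be merged into one.  A polynomial in the
  contraction can thus be shrunk until no two of its exponents are congruent modulo \<open>L\<close>, and then the
  functionals read off its coefficients and show that they all vanish.
\<close>

section \<open>Ideals closed under an endomorphism\<close>

lemma gen_sigma_ideal_is_sigma_ideal: "sigma_ideal \<tau> (gen_sigma_ideal \<tau> S)"
  unfolding gen_sigma_ideal_def by (rule hull_in) (auto simp: sigma_ideal_def)

lemma gen_sigma_ideal_superset: "S \<subseteq> gen_sigma_ideal \<tau> S"
  unfolding gen_sigma_ideal_def by (rule hull_subset)

lemma gen_sigma_ideal_base: "s \<in> S \<Longrightarrow> s \<in> gen_sigma_ideal \<tau> S"
  using gen_sigma_ideal_superset by (rule subsetD)

lemma gen_sigma_ideal_least: "S \<subseteq> I \<Longrightarrow> sigma_ideal \<tau> I \<Longrightarrow> gen_sigma_ideal \<tau> S \<subseteq> I"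
  unfolding gen_sigma_ideal_def by (rule hull_minimal)

lemma sigma_idealD:
  assumes "sigma_ideal \<tau> I"
  shows sigma_ideal_zero: "0 \<in> I"
    and sigma_ideal_add: "p \<in> I \<Longrightarrow> q \<in> I \<Longrightarrow> p + q \<in> I"
    and sigma_ideal_mult: "p \<in> I \<Longrightarrow> r * p \<in> I"
    and sigma_ideal_endo: "p \<in> I \<Longrightarrow> \<tau> p \<in> I"
  using assms by (auto simp: sigma_ideal_def)

lemma sigma_ideal_diff:
  assumes "sigma_ideal \<tau> I" "p \<in> I" "q \<in> I"
  shows "p - q \<in> I"
  using sigma_ideal_add[OF assms(1,2) sigma_ideal_mult[OF assms(1,3), of "- 1"]] by simp

lemma sigma_ideal_eq_UNIV: "sigma_ideal \<tau> I \<Longrightarrow> 1 \<in> I \<Longrightarrow> I = UNIV"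
  using sigma_ideal_mult[of \<tau> I 1] by auto

lemma module_times: "module ((*) :: 'r::comm_ring_1 \<Rightarrow> 'r \<Rightarrow> 'r)"
  by unfold_locales (simp_all add: algebra_simps)

text \<open>
  Applying the endomorphism to a combination \<open>\<Sum> r t\<close> of generators yields another such
  combination.  Hence facts about the \<open>\<sigma>\<close>-ideal need only be checked on multiples of generators.
  This matters for functionals that sum over a coset \<open>g + L\<close> of exponents: they are not compatible
  with \<open>\<sigma>\<close>, because \<open>x f - x g \<in> L\<close> does not imply \<open>f - g \<in> L\<close>.
\<close>

lemma gen_sigma_ideal_induct [consumes 2, case_names endo_add endo_mult zero add]:
  assumes p: "p \<in> gen_sigma_ideal \<tau> S"
    and closed: "\<tau> ` S \<subseteq> S"
    and \<tau>_add: "\<And>p q. \<tau> (p + q) = \<tau> p + \<tau> q"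
    and \<tau>_mult: "\<And>p q. \<tau> (p * q) = \<tau> p * \<tau> q"
    and zero: "P 0"
    and add: "\<And>r s p. s \<in> S \<Longrightarrow> P p \<Longrightarrow> P (r * s + p)"
  shows "P p"
proof -
  interpret M: module "(*) :: 'a \<Rightarrow> 'a \<Rightarrow> 'a" by (rule module_times)
  have \<tau>_0: "\<tau> 0 = 0" using \<tau>_add[of 0 0] by simp
  have "\<tau> q \<in> M.span S" if "q \<in> M.span S" for q
    using that
  proof (induction rule: M.span_induct_alt)
    case base
    show ?case by (simp add: \<tau>_0 M.span_zero)
  next
    case (step c x y)
    then have "\<tau> x \<in> M.span S" using closed by (auto intro: M.span_base)
    then show ?case using step by (simp add: \<tau>_add \<tau>_mult M.span_add M.span_scale)
  qed
  then have "sigma_ideal \<tau> (M.span S)"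
    by (auto simp: sigma_ideal_def intro: M.span_zero M.span_add M.span_scale)
  then have "p \<in> M.span S"
    using p gen_sigma_ideal_least[of S "M.span S" \<tau>] M.span_superset[of S] by blast
  then show ?thesis
    by (induction rule: M.span_induct_alt) (use zero add in auto)
qed

section \<open>Exponent vectors\<close>

definition int_exponent :: "(nat poly)^'n::finite \<Rightarrow> (int poly)^'n" where
  "int_exponent f = (\<chi> i. map_poly int (f $ i))"

lemma coeff_int_exponent: "coeff (int_exponent f $ i) j = int (coeff (f $ i) j)"
  by (simp add: int_exponent_def coeff_map_poly)

lemma coeff_pos_part: "coeff (pos_part f $ i) j = nat (coeff (f $ i) j)"
  by (simp add: pos_part_def coeff_map_poly)

lemma coeff_neg_part: "coeff (neg_part f $ i) j = nat (- coeff (f $ i) j)"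
  by (simp add: neg_part_def coeff_map_poly)

lemma int_exponent_0 [simp]: "int_exponent 0 = 0"
  by (simp add: vec_eq_iff poly_eq_iff coeff_int_exponent)

lemma int_exponent_add: "int_exponent (f + g) = int_exponent f + int_exponent g"
  by (simp add: vec_eq_iff poly_eq_iff coeff_int_exponent)

lemma int_exponent_shift: "int_exponent ([:0, 1:] *s f) = [:0, 1:] *s int_exponent f"
  by (simp add: vec_eq_iff poly_eq_iff coeff_int_exponent coeff_pCons split: nat.splits)

lemma int_exponent_eq_iff [simp]: "int_exponent f = int_exponent g \<longleftrightarrow> f = g"
  by (simp add: vec_eq_iff poly_eq_iff coeff_int_exponent)

lemma int_exponent_pos_part: "int_exponent (pos_part f) = f + int_exponent (neg_part f)"
  by (simp add: vec_eq_iff poly_eq_iff coeff_int_exponent coeff_pos_part coeff_neg_part)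

text \<open>
  The common summand is the entrywise minimum of the two exponents: the binomials
  \<open>Y^(f\<^sup>+) - c Y^(f\<^sup>-)\<close> are those in which no indeterminate can be cancelled.
\<close>

lemma exponents_differ_by_parts:
  obtains m where "g = m + pos_part (int_exponent g - int_exponent h)"
    and "h = m + neg_part (int_exponent g - int_exponent h)"
proof
  let ?m = "g - pos_part (int_exponent g - int_exponent h)"
  show "g = ?m + pos_part (int_exponent g - int_exponent h)"
    by (auto simp: vec_eq_iff poly_eq_iff coeff_int_exponent coeff_pos_part)
  show "h = ?m + neg_part (int_exponent g - int_exponent h)"
    by (auto simp: vec_eq_iff poly_eq_iff coeff_int_exponent coeff_pos_part coeff_neg_part)
qed

section \<open>Difference polynomials as Laurent difference polynomials\<close>

definition to_laurent :: "('f::field, 'n::finite) diff_poly \<Rightarrow> ('f, 'n) laurent_diff_poly" where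
  "to_laurent p =
     (\<Sum>f\<in>Poly_Mapping.keys p. Poly_Mapping.single (int_exponent f) (Poly_Mapping.lookup p f))"

lemma to_laurent_superset:
  assumes "finite A" "Poly_Mapping.keys p \<subseteq> A"
  shows "to_laurent p =
    (\<Sum>f\<in>A. Poly_Mapping.single (int_exponent f) (Poly_Mapping.lookup p f))"
  unfolding to_laurent_def
  using assms by (intro sum.mono_neutral_left) (auto simp: in_keys_iff)

lemma to_laurent_0 [simp]: "to_laurent 0 = 0"
  by (simp add: to_laurent_def)

lemma to_laurent_single [simp]:
  "to_laurent (Poly_Mapping.single f c) = Poly_Mapping.single (int_exponent f) c"
  by (simp add: to_laurent_def)

lemma to_laurent_add:
  fixes p q :: "('f::field, 'n::finite) diff_poly"
  shows "to_laurent (p + q) = to_laurent p + to_laurent q"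
proof -
  let ?A = "Poly_Mapping.keys p \<union> Poly_Mapping.keys q"
  have "to_laurent r = (\<Sum>f\<in>?A. Poly_Mapping.single (int_exponent f) (Poly_Mapping.lookup r f))"
    if "Poly_Mapping.keys r \<subseteq> ?A" for r :: "('f, 'n) diff_poly"
    by (rule to_laurent_superset) (use that in auto)
  then show ?thesis
    by (simp add: keys_add lookup_add single_add sum.distrib)
qed

lemma to_laurent_mult: "to_laurent (p * q) = to_laurent p * to_laurent q"
proof -
  have "to_laurent (Poly_Mapping.single f a * q) = to_laurent (Poly_Mapping.single f a) * to_laurent q"
    for f a
    by (induction q rule: poly_mapping_add_induct)
      (simp_all add: to_laurent_add distrib_left mult_single int_exponent_add)
  then show ?thesis
    by (induction p rule: poly_mapping_add_induct)
      (simp_all add: to_laurent_add distrib_right)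
qed

lemma to_laurent_diff: "to_laurent (p - q) = to_laurent p - to_laurent q"
  using to_laurent_add[of "p - q" q] by (simp add: algebra_simps)

lemma to_laurent_monom_Y: "to_laurent (monom_Y f) = monom_Y (int_exponent f)"
  by (simp add: monom_Y_def)

lemma to_laurent_const_Y: "to_laurent (const_Y c) = const_Y c"
  by (simp add: const_Y_def)

lemma to_laurent_1: "to_laurent 1 = 1"
  using to_laurent_monom_Y[of 0] by (simp add: monom_Y_0)

lemma to_laurent_sigma_ext:
  assumes "diff_field \<sigma>"
  shows "to_laurent (sigma_ext \<sigma> p) = sigma_ext \<sigma> (to_laurent p)"
proof -
  have "\<sigma> 0 = 0" using assms by (auto simp: diff_field_def)
  then show ?thesis
    by (induction p rule: poly_mapping_add_induct)
      (simp_all add: sigma_ext_zero sigma_ext_add[OF assms] to_laurent_add sigma_ext_single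
        int_exponent_shift del: One_nat_def)
qed

lemma lookup_to_laurent: "Poly_Mapping.lookup (to_laurent p) (int_exponent f) = Poly_Mapping.lookup p f"
  by (simp add: to_laurent_def lookup_sum lookup_single when_def in_keys_iff)

lemma to_laurent_eq_iff: "to_laurent p = to_laurent q \<longleftrightarrow> p = q"
  by (metis lookup_to_laurent poly_mapping_eqI)

lemma monom_Y_unit: "monom_Y (- f) * (monom_Y f * p) = (p :: ('f::field, 'n::finite) laurent_diff_poly)"
  by (simp flip: mult.assoc monom_Y_add add: monom_Y_0)

lemma const_Y_0: "const_Y 0 = 0"
  by (simp add: const_Y_def)

lemma const_Y_1: "const_Y 1 = 1"
  by (simp add: const_Y_def)

lemma const_Y_mult: "const_Y a * const_Y b = const_Y (a * b)"
  by (simp add: const_Y_def mult_single)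

lemma const_Y_uminus: "const_Y (- a) = - (const_Y a :: ('f::field, 'c::comm_semiring_1, 'n::finite) exp_alg)"
  by (simp add: const_Y_def single_uminus)

lemma const_Y_diff:
  "const_Y (a - b) = (const_Y a - const_Y b :: ('f::field, 'c::comm_semiring_1, 'n::finite) exp_alg)"
  by (simp add: const_Y_def single_diff)

lemma const_Y_monom_Y: "const_Y c * monom_Y f = Poly_Mapping.single f c"
  by (simp add: const_Y_def monom_Y_def mult_single)

lemma sigma_ext_monom_Y: "diff_field \<sigma> \<Longrightarrow> sigma_ext \<sigma> (monom_Y f) = monom_Y ([:0, 1:] *s f)"
  by (simp add: diff_field_def monom_Y_def sigma_ext_single)

lemma sigma_ext_const_Y: "diff_field \<sigma> \<Longrightarrow> sigma_ext \<sigma> (const_Y c) = const_Y (\<sigma> c)"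
  by (simp add: diff_field_def const_Y_def sigma_ext_single)

lemma sigma_ext_diff:
  fixes p q :: "('f::field, 'c::comm_semiring_1, 'n::finite) exp_alg"
  shows "diff_field \<sigma> \<Longrightarrow> sigma_ext \<sigma> (p - q) = sigma_ext \<sigma> p - sigma_ext \<sigma> q"
  using sigma_ext_add[of \<sigma> "p - q" q] by (simp add: algebra_simps)

section \<open>Contraction and localisation\<close>

lemma contraction_sigma_ideal:
  assumes "diff_field \<sigma>" "sigma_ideal (sigma_ext \<sigma>) I"
  shows "sigma_ideal (sigma_ext \<sigma>) (to_laurent -` I)"
  using sigma_idealD[OF assms(2)]
  by (auto simp: sigma_ideal_def to_laurent_add to_laurent_mult to_laurent_sigma_ext[OF assms(1)])

lemma contraction_normal:
  assumes "diff_field \<sigma>" "sigma_ideal (sigma_ext \<sigma>) I"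
  shows "normal_sigma_ideal \<sigma> (to_laurent -` I)"
  unfolding normal_sigma_ideal_def
proof (intro conjI allI impI)
  show "sigma_ideal (sigma_ext \<sigma>) (to_laurent -` I)"
    using assms by (rule contraction_sigma_ideal)
  fix a p
  assume "monom_Y a * p \<in> to_laurent -` I"
  then have "monom_Y (- int_exponent a) * (monom_Y (int_exponent a) * to_laurent p) \<in> I"
    by (intro sigma_ideal_mult[OF assms(2), of "monom_Y (int_exponent a) * to_laurent p"])
      (simp add: to_laurent_mult to_laurent_monom_Y)
  then show "p \<in> to_laurent -` I" by (simp add: monom_Y_unit)
qed

lemma clear_denominators:
  obtains m q where "monom_Y (int_exponent m) * p = to_laurent q"
proof -
  have "\<exists>m q. monom_Y (int_exponent m) * p = to_laurent q"
  proof (induction p rule: poly_mapping_add_induct)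
    case zero
    show ?case by (metis mult_zero_right to_laurent_0)
  next
    case (single_add f c p)
    then obtain m q where mq: "monom_Y (int_exponent m) * p = to_laurent q" by blast
    have f: "monom_Y (int_exponent (neg_part f)) * Poly_Mapping.single f c
        = to_laurent (Poly_Mapping.single (pos_part f) c)"
      by (simp add: monom_Y_def mult_single int_exponent_pos_part add.commute)
    have "monom_Y (int_exponent (m + neg_part f)) * (Poly_Mapping.single f c + p)
        = monom_Y (int_exponent m) * (monom_Y (int_exponent (neg_part f)) * Poly_Mapping.single f c)
          + monom_Y (int_exponent (neg_part f)) * (monom_Y (int_exponent m) * p)"
      by (simp add: int_exponent_add monom_Y_add algebra_simps)
    also have "\<dots> = to_laurent (monom_Y m * Poly_Mapping.single (pos_part f) c + monom_Y (neg_part f) * q)"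
      unfolding f mq by (simp only: to_laurent_add to_laurent_mult to_laurent_monom_Y)
    finally show ?case by blast
  qed
  then show ?thesis using that by blast
qed

text \<open>
  Clearing denominators moves any element of a Laurent ideal into its contraction, and monomials are
  units; so contraction loses no information about the ideal.
\<close>

lemma sigma_ideal_le_if_contraction_le:
  assumes I: "sigma_ideal (sigma_ext \<sigma>) I" and I': "sigma_ideal (sigma_ext \<sigma>) I'"
    and le: "to_laurent -` I \<subseteq> to_laurent -` I'"
  shows "I \<subseteq> I'"
proof
  fix p assume "p \<in> I"
  obtain m q where mq: "monom_Y (int_exponent m) * p = to_laurent q" by (rule clear_denominators)
  then have "to_laurent q \<in> I" using sigma_ideal_mult[OF I \<open>p \<in> I\<close>] by metis
  then have "monom_Y (int_exponent m) * p \<in> I'" using le mq by auto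
  then have "monom_Y (- int_exponent m) * (monom_Y (int_exponent m) * p) \<in> I'"
    by (rule sigma_ideal_mult[OF I'])
  then show "p \<in> I'" by (simp add: monom_Y_unit)
qed

definition localised_ideal ::
  "('f::field, 'n::finite) diff_poly set \<Rightarrow> ('f, 'n) laurent_diff_poly set" where
  "localised_ideal J = {p. \<exists>m. monom_Y (int_exponent m) * p \<in> to_laurent ` J}"

lemma localised_ideal_sigma_ideal:
  fixes J :: "('f::field, 'n::finite) diff_poly set"
  assumes \<sigma>: "diff_field \<sigma>" and J: "sigma_ideal (sigma_ext \<sigma>) J"
  shows "sigma_ideal (sigma_ext \<sigma>) (localised_ideal J)"
  unfolding sigma_ideal_def
proof (intro conjI allI ballI)
  show "0 \<in> localised_ideal J"
    using sigma_ideal_zero[OF J] by (force simp: localised_ideal_def)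
next
  fix p q :: "('f, 'n) laurent_diff_poly"
  assume "p \<in> localised_ideal J" "q \<in> localised_ideal J"
  then obtain m n a b where a: "a \<in> J" "monom_Y (int_exponent m) * p = to_laurent a"
    and b: "b \<in> J" "monom_Y (int_exponent n) * q = to_laurent b"
    by (auto simp: localised_ideal_def)
  have "monom_Y (int_exponent (m + n)) * (p + q)
      = monom_Y (int_exponent n) * (monom_Y (int_exponent m) * p)
        + monom_Y (int_exponent m) * (monom_Y (int_exponent n) * q)"
    by (simp add: int_exponent_add monom_Y_add algebra_simps)
  also have "\<dots> = to_laurent (monom_Y n * a + monom_Y m * b)"
    unfolding a b by (simp only: to_laurent_add to_laurent_mult to_laurent_monom_Y)
  finally show "p + q \<in> localised_ideal J"
    using a(1) b(1) sigma_ideal_add[OF J] sigma_ideal_mult[OF J]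
    unfolding localised_ideal_def by blast
next
  fix r p :: "('f, 'n) laurent_diff_poly" assume "p \<in> localised_ideal J"
  then obtain m a where a: "a \<in> J" "monom_Y (int_exponent m) * p = to_laurent a"
    by (auto simp: localised_ideal_def)
  obtain n s where s: "monom_Y (int_exponent n) * r = to_laurent s" by (rule clear_denominators)
  have "monom_Y (int_exponent (m + n)) * (r * p)
      = (monom_Y (int_exponent n) * r) * (monom_Y (int_exponent m) * p)"
    by (simp add: int_exponent_add monom_Y_add algebra_simps)
  also have "\<dots> = to_laurent (s * a)"
    unfolding a s by (simp only: to_laurent_mult)
  finally show "r * p \<in> localised_ideal J"
    using a(1) sigma_ideal_mult[OF J] unfolding localised_ideal_def by blast
next
  fix p assume "p \<in> localised_ideal J"
  then obtain m a where a: "a \<in> J" "monom_Y (int_exponent m) * p = to_laurent a"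
    by (auto simp: localised_ideal_def)
  have "monom_Y (int_exponent ([:0, 1:] *s m)) * sigma_ext \<sigma> p
      = sigma_ext \<sigma> (monom_Y (int_exponent m) * p)"
    by (simp add: sigma_ext_mult[OF \<sigma>] sigma_ext_monom_Y[OF \<sigma>] int_exponent_shift
        del: One_nat_def)
  also have "\<dots> = to_laurent (sigma_ext \<sigma> a)"
    unfolding a by (simp only: to_laurent_sigma_ext[OF \<sigma>])
  finally show "sigma_ext \<sigma> p \<in> localised_ideal J"
    using a(1) sigma_ideal_endo[OF J] unfolding localised_ideal_def by blast
qed

lemma to_laurent_image_subset_localised_ideal: "to_laurent ` J \<subseteq> localised_ideal J"
proof
  fix p assume "p \<in> to_laurent ` J"
  then have "monom_Y (int_exponent 0) * p \<in> to_laurent ` J" by (simp add: monom_Y_0)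
  then show "p \<in> localised_ideal J" unfolding localised_ideal_def by blast
qed

lemma contraction_localised_ideal:
  assumes "normal_sigma_ideal \<sigma> J"
  shows "to_laurent -` localised_ideal J = J"
proof (intro equalityI subsetI)
  fix p assume "p \<in> to_laurent -` localised_ideal J"
  then obtain m a where "a \<in> J" "to_laurent (monom_Y m * p) = to_laurent a"
    by (auto simp: localised_ideal_def to_laurent_mult to_laurent_monom_Y)
  then show "p \<in> J"
    using assms by (auto simp: normal_sigma_ideal_def to_laurent_eq_iff)
next
  fix p assume "p \<in> J"
  then show "p \<in> to_laurent -` localised_ideal J"
    using to_laurent_image_subset_localised_ideal by blast
qed

text \<open>
  A Laurent \<open>\<sigma>\<close>-ideal that contains the generators contracts to a \<open>\<sigma>\<close>-ideal that contains them.
  Localisation therefore turns binomial generators into binomial generators.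
\<close>

lemma localised_gen_sigma_ideal:
  assumes \<sigma>: "diff_field \<sigma>"
  shows "localised_ideal (gen_sigma_ideal (sigma_ext \<sigma>) S) = gen_sigma_ideal (sigma_ext \<sigma>) (to_laurent ` S)"
    (is "localised_ideal ?J = ?I")
proof
  have I: "sigma_ideal (sigma_ext \<sigma>) ?I" by (rule gen_sigma_ideal_is_sigma_ideal)
  have "?J \<subseteq> to_laurent -` ?I"
    using gen_sigma_ideal_superset[of "to_laurent ` S" "sigma_ext \<sigma>"]
    by (intro gen_sigma_ideal_least contraction_sigma_ideal[OF \<sigma> I]) auto
  show "localised_ideal ?J \<subseteq> ?I"
  proof
    fix p assume "p \<in> localised_ideal ?J"
    then obtain m where "monom_Y (int_exponent m) * p \<in> to_laurent ` ?J"
      by (auto simp: localised_ideal_def)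
    then have "monom_Y (int_exponent m) * p \<in> ?I"
      using \<open>?J \<subseteq> to_laurent -` ?I\<close> by auto
    then have "monom_Y (- int_exponent m) * (monom_Y (int_exponent m) * p) \<in> ?I"
      by (rule sigma_ideal_mult[OF I])
    then show "p \<in> ?I" by (simp add: monom_Y_unit)
  qed
  show "?I \<subseteq> localised_ideal ?J"
    using gen_sigma_ideal_superset[of S "sigma_ext \<sigma>"] to_laurent_image_subset_localised_ideal
    by (intro gen_sigma_ideal_least localised_ideal_sigma_ideal \<sigma> gen_sigma_ideal_is_sigma_ideal) blast
qed

lemma binomial_gen_sigma_ideal:
  "S \<subseteq> {const_Y a * monom_Y g + const_Y b * monom_Y h | a b g h. True} \<Longrightarrow>
    binomial_sigma_ideal \<sigma> (gen_sigma_ideal (sigma_ext \<sigma>) S)"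
  unfolding binomial_sigma_ideal_def by blast

lemma localised_binomial_sigma_ideal:
  assumes \<sigma>: "diff_field \<sigma>" and J: "binomial_sigma_ideal \<sigma> J"
  shows "binomial_sigma_ideal \<sigma> (localised_ideal J)"
proof -
  obtain S where S: "S \<subseteq> {const_Y a * monom_Y g + const_Y b * monom_Y h | a b g h. True}"
    and J_eq: "J = gen_sigma_ideal (sigma_ext \<sigma>) S"
    using J by (auto simp: binomial_sigma_ideal_def)
  have "to_laurent ` S \<subseteq> {const_Y a * monom_Y g + const_Y b * monom_Y h | a b g h. True}"
  proof
    fix p assume "p \<in> to_laurent ` S"
    then obtain a b g h where "p = to_laurent (const_Y a * monom_Y g + const_Y b * monom_Y h)"
      using S by blast
    then have "p = const_Y a * monom_Y (int_exponent g) + const_Y b * monom_Y (int_exponent h)"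
      by (simp add: to_laurent_add to_laurent_mult to_laurent_monom_Y to_laurent_const_Y)
    then show "p \<in> {const_Y a * monom_Y g + const_Y b * monom_Y h | a b g h. True}" by blast
  qed
  then show ?thesis
    unfolding J_eq localised_gen_sigma_ideal[OF \<sigma>] by (rule binomial_gen_sigma_ideal)
qed

section \<open>The ideals of a partial character\<close>

definition lin_ext :: "('a \<Rightarrow> 'f) \<Rightarrow> ('a \<Rightarrow>\<^sub>0 'f::field) \<Rightarrow> 'f" where
  "lin_ext w p = (\<Sum>f\<in>Poly_Mapping.keys p. Poly_Mapping.lookup p f * w f)"

lemma lin_ext_superset:
  assumes "finite A" "Poly_Mapping.keys p \<subseteq> A"
  shows "lin_ext w p = (\<Sum>f\<in>A. Poly_Mapping.lookup p f * w f)"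
  unfolding lin_ext_def
  using assms by (intro sum.mono_neutral_left) (auto simp: in_keys_iff)

lemma lin_ext_0 [simp]: "lin_ext w 0 = 0"
  by (simp add: lin_ext_def)

lemma lin_ext_single [simp]: "lin_ext w (Poly_Mapping.single f c) = c * w f"
  by (simp add: lin_ext_def)

lemma lin_ext_add:
  fixes p q :: "'a \<Rightarrow>\<^sub>0 'f::field"
  shows "lin_ext w (p + q) = lin_ext w p + lin_ext w q"
proof -
  let ?A = "Poly_Mapping.keys p \<union> Poly_Mapping.keys q"
  have "lin_ext w r = (\<Sum>f\<in>?A. Poly_Mapping.lookup r f * w f)"
    if "Poly_Mapping.keys r \<subseteq> ?A" for r :: "'a \<Rightarrow>\<^sub>0 'f"
    by (rule lin_ext_superset) (use that in auto)
  then show ?thesis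
    by (simp add: keys_add lookup_add distrib_right sum.distrib)
qed

lemma lin_ext_diff: "lin_ext w (p - q) = lin_ext w p - lin_ext w q"
  using lin_ext_add[of w "p - q" q] by (simp add: algebra_simps)

lemma lin_ext_to_laurent: "lin_ext w (to_laurent p) = lin_ext (\<lambda>f. w (int_exponent f)) p"
  by (induction p rule: poly_mapping_add_induct) (simp_all add: to_laurent_add lin_ext_add)

text \<open>
  Translating the character from \<open>L\<close> to every coset \<open>g + L\<close> is what makes all coefficients of a
  polynomial visible; the character itself weights only the terms with exponent in \<open>L\<close>.
\<close>

definition coset_weight ::
  "((int poly)^'n::finite) set \<Rightarrow> ((int poly)^'n \<Rightarrow> 'f::field) \<Rightarrow> (int poly)^'n \<Rightarrow> (int poly)^'n \<Rightarrow> 'f"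
  where "coset_weight L \<rho> g f = (if f - g \<in> L then \<rho> (f - g) else 0)"

context
  fixes \<sigma> :: "'f::field \<Rightarrow> 'f" and L :: "((int poly)^'n::finite) set" and \<rho> :: "(int poly)^'n \<Rightarrow> 'f"
  assumes \<sigma>: "diff_field \<sigma>" and char: "partial_character \<sigma> L \<rho>"
begin

lemma char_facts:
  shows zero_in_L: "0 \<in> L"
    and L_add: "f \<in> L \<Longrightarrow> g \<in> L \<Longrightarrow> f + g \<in> L"
    and L_shift: "f \<in> L \<Longrightarrow> [:0, 1:] *s f \<in> L"
    and L_diff: "f \<in> L \<Longrightarrow> g \<in> L \<Longrightarrow> f - g \<in> L"
    and \<rho>_nonzero: "f \<in> L \<Longrightarrow> \<rho> f \<noteq> 0"
    and \<rho>_add: "f \<in> L \<Longrightarrow> g \<in> L \<Longrightarrow> \<rho> (f + g) = \<rho> f * \<rho> g"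
    and \<rho>_shift: "f \<in> L \<Longrightarrow> \<rho> ([:0, 1:] *s f) = \<sigma> (\<rho> f)"
  using char module.subspace_0[OF module_vec, of L] module.subspace_add[OF module_vec, of L f g]
    module.subspace_scale[OF module_vec, of L f] module.subspace_diff[OF module_vec, of L f g]
  by (auto simp: partial_character_def)

lemma \<rho>_0: "\<rho> 0 = 1"
  using \<rho>_add[of 0 0] \<rho>_nonzero[of 0] zero_in_L by simp

lemma coset_weight_shift:
  assumes "f \<in> L"
  shows "coset_weight L \<rho> g (h + f) = \<rho> f * coset_weight L \<rho> g h"
proof -
  have split: "h + f - g = (h - g) + f" by simp
  have "h + f - g \<in> L \<longleftrightarrow> h - g \<in> L"
    using L_add[of "h - g" f] L_diff[of "h + f - g" f] assms by (auto simp: algebra_simps)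
  then show ?thesis
    using \<rho>_add[of "h - g" f] assms unfolding coset_weight_def split by auto
qed

text \<open>
  Multiplying \<open>Y^h\<close> by \<open>Y^f\<close> with \<open>f \<in> L\<close> stays in the coset and changes the weight by the factor
  \<open>\<rho>(f)\<close>, exactly as multiplying by the constant \<open>\<rho>(f)\<close> does.
\<close>

lemma coset_weight_vanishes:
  assumes "p \<in> laurent_char_ideal \<sigma> L \<rho>"
  shows "lin_ext (coset_weight L \<rho> g) p = 0"
proof -
  have gens: "sigma_ext \<sigma> ` (\<lambda>f. monom_Y f - const_Y (\<rho> f)) ` L \<subseteq> (\<lambda>f. monom_Y f - const_Y (\<rho> f)) ` L"
    using L_shift \<rho>_shift
    by (auto simp: sigma_ext_diff[OF \<sigma>] sigma_ext_monom_Y[OF \<sigma>] sigma_ext_const_Y[OF \<sigma>] image_iff)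
      metis
  have multiple: "lin_ext (coset_weight L \<rho> g) (r * (monom_Y f - const_Y (\<rho> f))) = 0"
    if "f \<in> L" for r f
  proof (induction r rule: poly_mapping_add_induct)
    case (single_add h c r)
    have "Poly_Mapping.single h c * (monom_Y f - const_Y (\<rho> f))
        = Poly_Mapping.single (h + f) c - Poly_Mapping.single h (c * \<rho> f)"
      by (simp add: monom_Y_def const_Y_def right_diff_distrib mult_single)
    then show ?case
      using single_add coset_weight_shift[OF that, of g h]
      by (simp add: distrib_right lin_ext_add lin_ext_diff)
  qed simp
  from assms gens show ?thesis
    unfolding laurent_char_ideal_def
  proof (induction rule: gen_sigma_ideal_induct)
    case (add r s p)
    then show ?case using multiple by (auto simp: lin_ext_add)
  qed (simp_all add: sigma_ext_add[OF \<sigma>] sigma_ext_mult[OF \<sigma>])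
qed

text \<open>
  After division by the common factor of its two terms, such a binomial is one of the generators.
\<close>

lemma congruent_binomial_in_char_ideal:
  assumes "int_exponent g - int_exponent h \<in> L"
  shows "monom_Y g - const_Y (\<rho> (int_exponent g - int_exponent h)) * monom_Y h \<in> char_ideal \<sigma> L \<rho>"
proof -
  let ?f = "int_exponent g - int_exponent h"
  obtain m where m: "g = m + pos_part ?f" "h = m + neg_part ?f"
    by (rule exponents_differ_by_parts)
  have "monom_Y (pos_part ?f) - const_Y (\<rho> ?f) * monom_Y (neg_part ?f) \<in> char_ideal \<sigma> L \<rho>"
    unfolding char_ideal_def using assms
    by (intro gen_sigma_ideal_base image_eqI[where x = ?f] refl)
  then have "monom_Y m * (monom_Y (pos_part ?f) - const_Y (\<rho> ?f) * monom_Y (neg_part ?f)) \<in> char_ideal \<sigma> L \<rho>"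
    unfolding char_ideal_def by (rule sigma_ideal_mult[OF gen_sigma_ideal_is_sigma_ideal])
  also have "monom_Y m * (monom_Y (pos_part ?f) - const_Y (\<rho> ?f) * monom_Y (neg_part ?f))
      = monom_Y (m + pos_part ?f) - const_Y (\<rho> ?f) * monom_Y (m + neg_part ?f)"
    by (simp add: monom_Y_add algebra_simps)
  finally show ?thesis using m by simp
qed

lemma char_ideal_le_contraction: "char_ideal \<sigma> L \<rho> \<subseteq> to_laurent -` laurent_char_ideal \<sigma> L \<rho>"
  unfolding char_ideal_def
proof (rule gen_sigma_ideal_least)
  have I: "sigma_ideal (sigma_ext \<sigma>) (laurent_char_ideal \<sigma> L \<rho>)"
    unfolding laurent_char_ideal_def by (rule gen_sigma_ideal_is_sigma_ideal)
  then show "sigma_ideal (sigma_ext \<sigma>) (to_laurent -` laurent_char_ideal \<sigma> L \<rho>)"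
    by (rule contraction_sigma_ideal[OF \<sigma>])
  show "(\<lambda>f. monom_Y (pos_part f) - const_Y (\<rho> f) * monom_Y (neg_part f)) ` L
      \<subseteq> to_laurent -` laurent_char_ideal \<sigma> L \<rho>"
  proof clarsimp
    fix f assume "f \<in> L"
    then have "monom_Y f - const_Y (\<rho> f) \<in> laurent_char_ideal \<sigma> L \<rho>"
      unfolding laurent_char_ideal_def
      by (intro gen_sigma_ideal_base image_eqI[where x = f] refl)
    then have "monom_Y (int_exponent (neg_part f)) * (monom_Y f - const_Y (\<rho> f)) \<in> laurent_char_ideal \<sigma> L \<rho>"
      by (rule sigma_ideal_mult[OF I])
    also have "monom_Y (int_exponent (neg_part f)) * (monom_Y f - const_Y (\<rho> f))
        = to_laurent (monom_Y (pos_part f) - const_Y (\<rho> f) * monom_Y (neg_part f))"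
      by (simp add: to_laurent_diff to_laurent_mult to_laurent_monom_Y to_laurent_const_Y
          int_exponent_pos_part monom_Y_add algebra_simps)
    finally show "to_laurent (monom_Y (pos_part f) - const_Y (\<rho> f) * monom_Y (neg_part f))
        \<in> laurent_char_ideal \<sigma> L \<rho>" .
  qed
qed

text \<open>
  The induction on the number of terms merges two terms whose exponents are congruent modulo \<open>L\<close>.
  If there is no such pair, then the functional of the coset of a term sees only that term.
\<close>

lemma in_char_ideal_if_weights_vanish:
  assumes "\<And>g. lin_ext (coset_weight L \<rho> g) (to_laurent p) = 0"
  shows "p \<in> char_ideal \<sigma> L \<rho>"
  using assms
proof (induction "card (Poly_Mapping.keys p)" arbitrary: p rule: less_induct)
  case less
  have J: "sigma_ideal (sigma_ext \<sigma>) (char_ideal \<sigma> L \<rho>)"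
    unfolding char_ideal_def by (rule gen_sigma_ideal_is_sigma_ideal)
  show ?case
  proof (cases "p = 0")
    case True
    then show ?thesis using sigma_ideal_zero[OF J] by simp
  next
    case False
    then obtain g where g: "g \<in> Poly_Mapping.keys p" by (metis all_not_in_conv keys_eq_empty)
    let ?w = "\<lambda>f. coset_weight L \<rho> (int_exponent g) (int_exponent f)"
    have "(\<Sum>f\<in>Poly_Mapping.keys p. Poly_Mapping.lookup p f * ?w f) = 0"
      using less.prems[of "int_exponent g"] unfolding lin_ext_to_laurent unfolding lin_ext_def .
    moreover have "Poly_Mapping.lookup p g * ?w g \<noteq> 0"
      using g zero_in_L \<rho>_0 by (simp add: coset_weight_def in_keys_iff)
    ultimately have "\<exists>h\<in>Poly_Mapping.keys p - {g}. Poly_Mapping.lookup p h * ?w h \<noteq> 0"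
      using g by (metis (no_types, lifting) add.right_neutral finite_keys sum.neutral sum.remove)
    then obtain h where h: "h \<in> Poly_Mapping.keys p" "h \<noteq> g" "int_exponent h - int_exponent g \<in> L"
      by (auto simp: coset_weight_def split: if_splits)
    have gh: "int_exponent g - int_exponent h \<in> L"
      using L_diff[OF zero_in_L h(3)] by simp
    define c where "c = \<rho> (int_exponent g - int_exponent h)"
    define b where "b = const_Y (Poly_Mapping.lookup p g) * (monom_Y g - const_Y c * monom_Y h)"
    have b_in: "b \<in> char_ideal \<sigma> L \<rho>"
      unfolding b_def c_def
      by (intro sigma_ideal_mult[OF J] congruent_binomial_in_char_ideal gh)
    have b_eq: "b = Poly_Mapping.single g (Poly_Mapping.lookup p g)
        - Poly_Mapping.single h (Poly_Mapping.lookup p g * c)"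
      by (simp add: b_def right_diff_distrib const_Y_def monom_Y_def mult_single)
    have "Poly_Mapping.keys (p - b) \<subseteq> Poly_Mapping.keys p - {g}"
      using h(1,2) by (auto simp: b_eq in_keys_iff lookup_minus lookup_single when_def split: if_splits)
    then have "card (Poly_Mapping.keys (p - b)) < card (Poly_Mapping.keys p)"
      using g by (intro psubset_card_mono) auto
    moreover have "lin_ext (coset_weight L \<rho> k) (to_laurent (p - b)) = 0" for k
      using less.prems[of k] coset_weight_vanishes[of "to_laurent b" k] b_in char_ideal_le_contraction
      by (auto simp: to_laurent_diff lin_ext_diff)
    ultimately have "p - b \<in> char_ideal \<sigma> L \<rho>" by (rule less.hyps)
    then show ?thesis using sigma_ideal_add[OF J _ b_in] by fastforce
  qed
qed

theorem contraction_laurent_char_ideal: "to_laurent -` laurent_char_ideal \<sigma> L \<rho> = char_ideal \<sigma> L \<rho>"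
  using char_ideal_le_contraction coset_weight_vanishes in_char_ideal_if_weights_vanish
  by (intro equalityI subsetI) auto

end

lemma char_ideal_binomial:
  fixes \<rho> :: "(int poly)^'n::finite \<Rightarrow> 'f::field"
  shows "binomial_sigma_ideal \<sigma> (char_ideal \<sigma> L \<rho>)"
proof -
  have generator: "monom_Y (pos_part f) - const_Y (\<rho> f) * monom_Y (neg_part f)
      = const_Y 1 * monom_Y (pos_part f) + const_Y (- \<rho> f) * monom_Y (neg_part f)" for f
    by (simp add: const_Y_uminus const_Y_1)
  have "(\<lambda>f. monom_Y (pos_part f) - const_Y (\<rho> f) * monom_Y (neg_part f)) ` L
      \<subseteq> ({const_Y a * monom_Y g + const_Y b * monom_Y h | a b g h. True} :: ('f, 'n) diff_poly set)"
    unfolding generator by (rule image_subsetI) blast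
  then show ?thesis
    unfolding char_ideal_def by (rule binomial_gen_sigma_ideal)
qed

section \<open>Proper Laurent binomial ideals come from partial characters\<close>

text \<open>
  Multiplication by an integer polynomial is built from addition, negation and multiplication
  by \<open>x\<close>, so closure under these three operations suffices.
\<close>

lemma subspace_int_poly_vec:
  fixes L :: "((int poly)^'n::finite) set"
  assumes zero: "0 \<in> L" and add: "\<And>f g. f \<in> L \<Longrightarrow> g \<in> L \<Longrightarrow> f + g \<in> L"
    and uminus: "\<And>f. f \<in> L \<Longrightarrow> - f \<in> L" and shift: "\<And>f. f \<in> L \<Longrightarrow> [:0, 1:] *s f \<in> L"
  shows "module.subspace (*s) L"
proof (rule module.subspaceI[OF module_vec zero add])
  have const: "[:k:] *s f \<in> L" if "f \<in> L" for k f
  proof (induction k rule: int_induct[where k = 0])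
    case base
    then show ?case using zero by simp
  next
    case (step1 i)
    have "[:i + 1:] *s f = [:i:] *s f + f"
      by (simp add: vec_eq_iff algebra_simps smult_add_left)
    then show ?case using add[OF step1(2) that] by metis
  next
    case (step2 i)
    have "[:i - 1:] *s f = [:i:] *s f + - f"
      by (simp add: vec_eq_iff algebra_simps smult_diff_left)
    then show ?case using add[OF step2(2) uminus[OF that]] by metis
  qed
  show "p *s f \<in> L" if "f \<in> L" for p f
  proof (induction p)
    case 0
    then show ?case using zero by simp
  next
    case (pCons a p)
    have "pCons a p *s f = [:a:] *s f + [:0, 1:] *s (p *s f)"
      by (simp add: vec_eq_iff)
    then show ?case using add[OF const[OF that] shift[OF pCons(2)]] by metis
  qed
qed

text \<open>
  The character is read off from the relation "\<open>Y^f\<close> is congruent to the nonzero constant \<open>c\<close>".  It is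
  multiplicative and compatible with \<open>\<sigma>\<close>, and properness makes \<open>c\<close> unique.  Properness also
  excludes generators with a single nonzero term, since these are units.
\<close>

theorem proper_binomial_laurent_ideal_is_char_ideal:
  fixes I :: "('f::field, 'n::finite) laurent_diff_poly set"
  assumes \<sigma>: "diff_field \<sigma>" and bin: "binomial_sigma_ideal \<sigma> I" and proper: "I \<noteq> UNIV"
  obtains L \<rho> where "partial_character \<sigma> L \<rho>" and "I = laurent_char_ideal \<sigma> L \<rho>"
proof -
  obtain S where S: "S \<subseteq> {const_Y a * monom_Y g + const_Y b * monom_Y h | a b g h. True}"
    and I_eq: "I = gen_sigma_ideal (sigma_ext \<sigma>) S"
    using bin by (auto simp: binomial_sigma_ideal_def)
  have I: "sigma_ideal (sigma_ext \<sigma>) I"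
    unfolding I_eq by (rule gen_sigma_ideal_is_sigma_ideal)
  note I_mult = sigma_ideal_mult[OF I] and I_add = sigma_ideal_add[OF I]
  have no_const: "const_Y c \<notin> I" if "c \<noteq> 0" for c
  proof
    assume "const_Y c \<in> I"
    then have "const_Y (inverse c) * const_Y c \<in> I" by (rule I_mult)
    then show False
      using sigma_ideal_eq_UNIV[OF I] proper that by (simp add: const_Y_mult const_Y_1)
  qed
  define R where "R f c \<longleftrightarrow> c \<noteq> 0 \<and> monom_Y f - const_Y c \<in> I" for f c
  have R_unique: "c = d" if "R f c" "R f d" for f c d
  proof -
    have "const_Y (c - d) \<in> I"
      using sigma_ideal_diff[OF I, of "monom_Y f - const_Y d" "monom_Y f - const_Y c"] that
      by (simp add: R_def const_Y_diff)
    then show ?thesis using no_const[of "c - d"] by auto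
  qed
  have R_0: "R 0 1"
    using sigma_ideal_zero[OF I] by (simp add: R_def monom_Y_0 const_Y_1)
  have R_add: "R (f + g) (c * d)" if "R f c" "R g d" for f g c d
  proof -
    have "monom_Y f * (monom_Y g - const_Y d) + const_Y d * (monom_Y f - const_Y c) \<in> I"
      using that by (intro I_add I_mult) (auto simp: R_def)
    also have "monom_Y f * (monom_Y g - const_Y d) + const_Y d * (monom_Y f - const_Y c)
        = monom_Y (f + g) - const_Y (c * d)"
      by (simp add: monom_Y_add algebra_simps flip: const_Y_mult)
    finally show ?thesis using that by (simp add: R_def)
  qed
  have R_uminus: "R (- f) (inverse c)" if "R f c" for f c
  proof -
    have c: "c \<noteq> 0" using that by (simp add: R_def)
    have "(- const_Y (inverse c) * monom_Y (- f)) * (monom_Y f - const_Y c) \<in> I"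
      using that by (intro I_mult) (auto simp: R_def)
    also have "(- const_Y (inverse c) * monom_Y (- f)) * (monom_Y f - const_Y c)
        = (const_Y (inverse c) * const_Y c) * monom_Y (- f) - const_Y (inverse c) * (monom_Y (- f) * (monom_Y f * 1))"
      by (simp add: algebra_simps)
    also have "\<dots> = monom_Y (- f) - const_Y (inverse c)"
      using c by (simp only: monom_Y_unit const_Y_mult) (simp add: const_Y_1)
    finally show ?thesis using c by (simp add: R_def)
  qed
  have R_shift: "R ([:0, 1:] *s f) (\<sigma> c)" if "R f c" for f c
    using that sigma_ideal_endo[OF I, of "monom_Y f - const_Y c"] \<sigma>
    by (auto simp: R_def sigma_ext_diff[OF \<sigma>] sigma_ext_monom_Y[OF \<sigma>] sigma_ext_const_Y[OF \<sigma>]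
        diff_field_def)
  define L where "L = {f. \<exists>c. R f c}"
  define \<rho> where "\<rho> f = (THE c. R f c)" for f
  have \<rho>_eq: "\<rho> f = c" if "R f c" for f c
    unfolding \<rho>_def using that R_unique by blast
  have R_\<rho>: "R f (\<rho> f)" if "f \<in> L" for f
    using that \<rho>_eq by (auto simp: L_def)
  have "module.subspace (*s) L"
    by (rule subspace_int_poly_vec) (unfold L_def mem_Collect_eq, use R_0 R_add R_uminus R_shift in \<open>blast+\<close>)
  then have char: "partial_character \<sigma> L \<rho>"
    unfolding partial_character_def
    using \<rho>_eq[OF R_add[OF R_\<rho> R_\<rho>]] \<rho>_eq[OF R_shift[OF R_\<rho>]] R_\<rho>
    by (simp add: R_def)
  have I': "sigma_ideal (sigma_ext \<sigma>) (laurent_char_ideal \<sigma> L \<rho>)"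
    unfolding laurent_char_ideal_def by (rule gen_sigma_ideal_is_sigma_ideal)
  have "laurent_char_ideal \<sigma> L \<rho> \<subseteq> I"
    unfolding laurent_char_ideal_def
    by (rule gen_sigma_ideal_least[OF image_subsetI I]) (use R_\<rho> in \<open>simp add: R_def\<close>)
  moreover have "I \<subseteq> laurent_char_ideal \<sigma> L \<rho>"
  proof (unfold I_eq, rule gen_sigma_ideal_least[OF _ I'], rule subsetI)
    fix s assume "s \<in> S"
    then obtain a b g h where s: "s = const_Y a * monom_Y g + const_Y b * monom_Y h"
      using S by blast
    have sI: "s \<in> I" using \<open>s \<in> S\<close> unfolding I_eq by (rule gen_sigma_ideal_base)
    have term_not_in: "const_Y c * monom_Y f \<notin> I" if "c \<noteq> 0" for c f
    proof
      assume "const_Y c * monom_Y f \<in> I"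
      then have "monom_Y (- f) * (const_Y c * monom_Y f) \<in> I" by (rule I_mult)
      then have "monom_Y (- f) * (monom_Y f * const_Y c) \<in> I" by (simp add: mult.commute)
      then show False using no_const[OF that] by (simp add: monom_Y_unit)
    qed
    have zero_iff: "a = 0 \<longleftrightarrow> b = 0"
      using sI term_not_in[of a g] term_not_in[of b h] unfolding s
      by (cases "a = 0"; cases "b = 0") (simp_all add: const_Y_0)
    show "s \<in> laurent_char_ideal \<sigma> L \<rho>"
    proof (cases "a = 0")
      case True
      then show ?thesis using zero_iff sigma_ideal_zero[OF I'] by (simp add: s const_Y_0)
    next
      case False
      \<comment> \<open>dividing by \<open>a Y^h\<close> turns the binomial into \<open>Y^(g - h) - (- b / a)\<close>\<close>
      define u v :: "('f, 'n) laurent_diff_poly"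
        where "u = const_Y a * monom_Y h" and "v = const_Y (inverse a) * monom_Y (- h)"
      have quotient: "v * s = monom_Y (g - h) - const_Y (- b / a)"
        unfolding s v_def const_Y_monom_Y distrib_left mult_single using False
        by (simp add: monom_Y_def const_Y_def single_uminus divide_inverse mult.commute)
      have "u * v = 1"
        using False unfolding u_def v_def const_Y_monom_Y mult_single by simp
      then have recover: "u * (v * s) = s" by (simp flip: mult.assoc)
      have "R (g - h) (- b / a)"
        using I_mult[OF sI, of v] False zero_iff unfolding quotient R_def by simp
      then have "g - h \<in> L" "\<rho> (g - h) = - b / a" using \<rho>_eq by (auto simp: L_def)
      then have "monom_Y (g - h) - const_Y (- b / a) \<in> laurent_char_ideal \<sigma> L \<rho>"
        unfolding laurent_char_ideal_def
        by (intro gen_sigma_ideal_base image_eqI[where x = "g - h"]) simp_all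
      then have "u * (v * s) \<in> laurent_char_ideal \<sigma> L \<rho>"
        unfolding quotient by (rule sigma_ideal_mult[OF I'])
      then show ?thesis using recover by simp
    qed
  qed
  ultimately show ?thesis using that char by blast
qed

section \<open>The correspondence\<close>

theorem theorem5p19:
  fixes \<sigma> :: "'f::field_char_0 \<Rightarrow> 'f"
  assumes "inversive_diff_field \<sigma>"
  shows "\<exists>\<Phi> :: ('f, 'n::finite) laurent_diff_poly set \<Rightarrow> ('f, 'n) diff_poly set.
      (\<forall>L \<rho>. partial_character \<sigma> L \<rho> \<longrightarrow>
         \<Phi> (laurent_char_ideal \<sigma> L \<rho>) = char_ideal \<sigma> L \<rho>) \<and>
      (\<forall>I :: ('f, 'n) laurent_diff_poly set. binomial_sigma_ideal \<sigma> I \<and> I \<noteq> UNIV \<longrightarrow>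
         (\<exists>L \<rho>. partial_character \<sigma> L \<rho> \<and> I = laurent_char_ideal \<sigma> L \<rho>)) \<and>
      bij_betw \<Phi>
        {I. binomial_sigma_ideal \<sigma> I \<and> I \<noteq> UNIV}
        {J. binomial_sigma_ideal \<sigma> J \<and> normal_sigma_ideal \<sigma> J \<and> J \<noteq> UNIV}"
proof (intro exI[of _ "\<lambda>I. to_laurent -` I"] conjI allI impI)
  have \<sigma>: "diff_field \<sigma>" using assms by (simp add: inversive_diff_field_def)
  have binD: "sigma_ideal (sigma_ext \<sigma>) I" if "binomial_sigma_ideal \<sigma> I"
    for I :: "('f, 'n) laurent_diff_poly set"
    using that gen_sigma_ideal_is_sigma_ideal by (auto simp: binomial_sigma_ideal_def)
  show "to_laurent -` laurent_char_ideal \<sigma> L \<rho> = char_ideal \<sigma> L \<rho>"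
    if "partial_character \<sigma> L \<rho>" for L :: "((int poly)^'n) set" and \<rho>
    using \<sigma> that by (rule contraction_laurent_char_ideal)
  show from_char: "\<exists>L \<rho>. partial_character \<sigma> L \<rho> \<and> I = laurent_char_ideal \<sigma> L \<rho>"
    if "binomial_sigma_ideal \<sigma> I \<and> I \<noteq> UNIV" for I :: "('f, 'n) laurent_diff_poly set"
    using proper_binomial_laurent_ideal_is_char_ideal[OF \<sigma>] that by metis
  have contraction_proper: "to_laurent -` I \<noteq> UNIV"
    if "sigma_ideal (sigma_ext \<sigma>) I" "I \<noteq> UNIV" for I :: "('f, 'n) laurent_diff_poly set"
    using that sigma_ideal_eq_UNIV to_laurent_1 by (metis UNIV_I vimageE)
  show "bij_betw (\<lambda>I :: ('f, 'n) laurent_diff_poly set. to_laurent -` I)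
      {I. binomial_sigma_ideal \<sigma> I \<and> I \<noteq> UNIV}
      {J. binomial_sigma_ideal \<sigma> J \<and> normal_sigma_ideal \<sigma> J \<and> J \<noteq> UNIV}"
  proof (rule bij_betw_imageI)
    show "inj_on (\<lambda>I :: ('f, 'n) laurent_diff_poly set. to_laurent -` I)
        {I. binomial_sigma_ideal \<sigma> I \<and> I \<noteq> UNIV}"
    proof (rule inj_onI)
      fix I I' :: "('f, 'n) laurent_diff_poly set"
      assume "I \<in> {I. binomial_sigma_ideal \<sigma> I \<and> I \<noteq> UNIV}" "I' \<in> {I. binomial_sigma_ideal \<sigma> I \<and> I \<noteq> UNIV}"
      then have "sigma_ideal (sigma_ext \<sigma>) I" "sigma_ideal (sigma_ext \<sigma>) I'" by (simp_all add: binD)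
      moreover assume "to_laurent -` I = to_laurent -` I'"
      ultimately show "I = I'" by (intro equalityI sigma_ideal_le_if_contraction_le) auto
    qed
    show "(\<lambda>I :: ('f, 'n) laurent_diff_poly set. to_laurent -` I) ` {I. binomial_sigma_ideal \<sigma> I \<and> I \<noteq> UNIV}
        = {J. binomial_sigma_ideal \<sigma> J \<and> normal_sigma_ideal \<sigma> J \<and> J \<noteq> UNIV}"
    proof (intro equalityI subsetI)
      fix J assume "J \<in> (\<lambda>I :: ('f, 'n) laurent_diff_poly set. to_laurent -` I) ` {I. binomial_sigma_ideal \<sigma> I \<and> I \<noteq> UNIV}"
      then obtain I where I: "binomial_sigma_ideal \<sigma> I" "I \<noteq> UNIV" and J: "J = to_laurent -` I"
        by blast
      obtain L \<rho> where "partial_character \<sigma> L \<rho>" "I = laurent_char_ideal \<sigma> L \<rho>"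
        using from_char I by blast
      then have "binomial_sigma_ideal \<sigma> J"
        by (simp add: J contraction_laurent_char_ideal[OF \<sigma>] char_ideal_binomial)
      then show "J \<in> {J. binomial_sigma_ideal \<sigma> J \<and> normal_sigma_ideal \<sigma> J \<and> J \<noteq> UNIV}"
        using contraction_normal[OF \<sigma> binD[OF I(1)]] contraction_proper[OF binD[OF I(1)] I(2)]
        by (simp add: J)
    next
      fix J :: "('f, 'n) diff_poly set"
      assume "J \<in> {J. binomial_sigma_ideal \<sigma> J \<and> normal_sigma_ideal \<sigma> J \<and> J \<noteq> UNIV}"
      then have J: "binomial_sigma_ideal \<sigma> J" "normal_sigma_ideal \<sigma> J" "J \<noteq> UNIV" by auto
      then have "to_laurent -` localised_ideal J = J" by (intro contraction_localised_ideal)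
      moreover from this J(3) have "localised_ideal J \<noteq> UNIV" by auto
      ultimately show "J \<in> (\<lambda>I :: ('f, 'n) laurent_diff_poly set. to_laurent -` I) ` {I. binomial_sigma_ideal \<sigma> I \<and> I \<noteq> UNIV}"
        using localised_binomial_sigma_ideal[OF \<sigma> J(1)] by (intro image_eqI[of _ _ "localised_ideal J"]) auto
    qed
  qed
qed

end
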